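(* $F(m,\mathbf{a})\bmod 2$ is $4$-periodic in each component of $\mathbf{a}$. That is: let $n\ge1$, $\mathbf{a}=(a_1,\dots,a_n)\in\mathbb{Z}^n$, $m\in\mathbb{N}$ and $1\le j\le n$, and let $\mathbf{a}'=(a_1',\dots,a_n')$ with $a_i'=a_i$ for $i\ne j$ and $a_j'=a_j+4$. Then $F(m,\mathbf{a})\equiv F(m,\mathbf{a}')\bmod 2$.
   Context: $\mathbb{N}=\{1,2,3,\dots\}$. For $k\in\mathbb{N}$, $\mathcal{P}(k)$ is the set of distinct prime factors of $k$. Given $\mathbf{a}=(a_1,\dots,a_n)\in\mathbb{Z}^n$, let $\theta_1,\dots,\theta_n$ be the roots (with multiplicity, in $\mathbb{C}$) of $X^n-a_1X^{n-1}+a_2X^{n-2}-\dots+(-1)^na_n$ (so $a_i$ is the $i$-th elementary symmetric function of the roots), and define $$F(m,\mathbf{a}):=\sum_{j\mid m}(-1)^j\,\frac{\sum_{i=1}^n\theta_i^j}{j}\prod_{p\in\mathcal{P}(m/j)}\Big(1-\frac1p\Big).$$ It is known that $F(m,\mathbf{a})\in\mathbb{Z}$ for all $m\in\mathbb{N}$. *)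

theory Defs
  imports Complex_Main "HOL-Computational_Algebra.Computational_Algebra" "HOL-Number_Theory.Cong"
begin

text \<open>
  A vector in \<open>\<int>\<^sup>n\<close> is represented by a function \<open>a :: nat \<Rightarrow> int\<close> of which only the values
  at \<open>1, \<dots>, n\<close> are used. The coefficients are signed so that \<open>a i\<close> is the \<open>i\<close>-th
  elementary symmetric function of the roots.
\<close>

definition esym_poly :: "nat \<Rightarrow> (nat \<Rightarrow> int) \<Rightarrow> complex poly" where
  "esym_poly n a = monom 1 n + (\<Sum>i=1..n. monom ((-1) ^ i * of_int (a i)) (n - i))"

text \<open>
  The multiset \<open>proots\<close> counts roots with multiplicity, so the inner sum below is the
  \<open>j\<close>-th power sum \<open>\<theta>\<^sub>1^j + \<dots> + \<theta>\<^sub>n^j\<close>. The value is an integer for \<open>m \<ge> 1\<close>, but it is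
  defined as a complex number because that is not evident from the formula.
\<close>

definition F :: "nat \<Rightarrow> nat \<Rightarrow> (nat \<Rightarrow> int) \<Rightarrow> complex" where
  "F n m a = (\<Sum>j | j dvd m.
     (-1) ^ j * ((\<Sum>\<theta>\<in>#proots (esym_poly n a). \<theta> ^ j) / of_nat j)
       * (\<Prod>p\<in>prime_factors (m div j). 1 - 1 / of_nat p))"

end

theory Submission
  imports Defs "HOL-Number_Theory.Totient"
begin

text \<open>
  Let \<open>A = 1 + a\<^sub>1 X + \<dots> + a\<^sub>n X\<^sup>n = \<Prod>(1 + \<theta>\<^sub>i X)\<close>. The coefficient of \<open>X\<^sup>d\<close> in the logarithmic
  derivative \<open>X A' / A\<close> is \<open>- (-1)\<^sup>d \<Sum>\<theta>\<^sub>i\<^sup>d\<close>, and \<open>\<Prod>(1 - 1/p)\<close> over the primes \<open>p\<close> dividing \<open>k\<close> is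
  \<open>\<phi>(k)/k\<close>. Hence \<open>F(m, a)\<close> equals
  \<open>\<Phi>\<^sub>m(A)\<close>, where \<open>\<Phi>\<^sub>m(f) = - (1/m) \<Sum>\<phi>(m/d) [X\<^sup>d](X f' / f)\<close> with the sum over the divisors \<open>d\<close> of \<open>m\<close>
  (\<open>F_eq_necklace\<close>). The functional \<open>\<Phi>\<^sub>m\<close> makes sense for every power series with constant
  term 1 and turns products into sums. Two facts about it give the theorem.

  \<^item> \<open>\<Phi>\<^sub>m(f)\<close> is an integer whenever \<open>f\<close> has integer coefficients (\<open>necklace_Ints\<close>). Since
    \<open>\<Sum>\<phi>(e) = l\<close> over the divisors \<open>e\<close> of \<open>l\<close>, one has \<open>\<Phi>\<^sub>m(1 - X\<^sup>k) = 1\<close> if \<open>k\<close> divides \<open>m\<close>, and \<open>0\<close>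
    otherwise. Multiplying \<open>f\<close> by suitable powers of \<open>1 \<plusminus> X\<^sup>k\<close> for \<open>k = 1, \<dots>, m\<close> therefore changes
    \<open>\<Phi>\<^sub>m(f)\<close> by integers and removes all coefficients up to degree \<open>m\<close>, which are the only ones that
    \<open>\<Phi>\<^sub>m\<close> sees.

  \<^item> If \<open>f\<close> and \<open>g\<close> are congruent modulo 4, then \<open>f g\<close> is the square of a power series \<open>r\<close> with integer
    coefficients (\<open>sqrt_of_mult_cong_4\<close>). This is the fact that \<open>sqrt (1 + 4 y)\<close> has integer
    coefficients in \<open>y\<close>, applied to \<open>f / g\<close>.

  Consequently \<open>\<Phi>\<^sub>m(f) + \<Phi>\<^sub>m(g) = 2 \<Phi>\<^sub>m(r)\<close> is even as soon as \<open>f\<close> and \<open>g\<close> are congruent modulo 4. Adding 4 to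
  one of the \<open>a\<^sub>j\<close> changes \<open>A\<close> by \<open>4 X\<^sup>j\<close>.
\<close>

section \<open>Logarithmic derivatives of power series\<close>

text \<open>
  This is \<open>X f' / f\<close> rather than \<open>f' / f\<close>, so that its coefficients are power sums without an index
  shift.
\<close>

definition log_deriv :: "complex fps \<Rightarrow> complex fps" where
  "log_deriv f = fps_X * fps_deriv f * inverse f"

lemma log_deriv_unique:
  assumes "f $ 0 \<noteq> 0" and "g * f = fps_X * fps_deriv f"
  shows "log_deriv f = g"
proof -
  have "log_deriv f = g * (f * inverse f)"
    by (simp add: log_deriv_def assms(2)[symmetric] mult.assoc)
  thus ?thesis using inverse_mult_eq_1[OF assms(1)] by (simp add: mult.commute)
qed

lemma log_deriv_mult_self:
  assumes "f $ 0 \<noteq> 0"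
  shows "log_deriv f * f = fps_X * fps_deriv f"
  using inverse_mult_eq_1[OF assms] by (simp add: log_deriv_def mult.assoc)

lemma log_deriv_mult:
  assumes "f $ 0 \<noteq> 0" and "g $ 0 \<noteq> 0"
  shows "log_deriv (f * g) = log_deriv f + log_deriv g"
proof (rule log_deriv_unique)
  have "(log_deriv f + log_deriv g) * (f * g) =
    (log_deriv f * f) * g + f * (log_deriv g * g)" by (simp add: algebra_simps)
  also have "\<dots> = fps_X * fps_deriv (f * g)"
    unfolding log_deriv_mult_self[OF assms(1)] log_deriv_mult_self[OF assms(2)]
    by (simp add: algebra_simps)
  finally show "(log_deriv f + log_deriv g) * (f * g) = fps_X * fps_deriv (f * g)" .
qed (use assms in simp)

lemma fps_nth_prod_mset_0: "(\<Prod>x\<in>#M. f x) $ 0 = (\<Prod>x\<in>#M. f x $ 0)"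
  by (induction M) auto

lemma log_deriv_prod_mset:
  assumes "\<And>x. x \<in># M \<Longrightarrow> f x $ 0 = 1"
  shows "log_deriv (\<Prod>x\<in>#M. f x) $ d = (\<Sum>x\<in>#M. log_deriv (f x) $ d)"
  using assms
proof (induction M)
  case empty
  show ?case by (simp add: log_deriv_def)
next
  case (add x M)
  have "(\<Prod>x\<in>#M. f x) $ 0 = (\<Prod>x\<in>#M. 1)"
    unfolding fps_nth_prod_mset_0 using add.prems
    by (intro arg_cong[where f = prod_mset] image_mset_cong) auto
  with add show ?case by (simp add: log_deriv_mult)
qed

lemma log_deriv_linear_factor:
  assumes "d > 0"
  shows "log_deriv (1 + fps_const x * fps_X) $ d = - ((- x) ^ d)"
proof -
  let ?g = "Abs_fps (\<lambda>d. if d = 0 then 0 else - ((- x) ^ d))"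
  have "log_deriv (1 + fps_const x * fps_X) = ?g"
  proof (rule log_deriv_unique)
    have "?g * (1 + fps_const x * fps_X) = ?g + fps_X * (fps_const x * ?g)"
      by (simp add: algebra_simps)
    also have "\<dots> = fps_X * fps_const x"
    proof (rule fps_ext)
      show "(?g + fps_X * (fps_const x * ?g)) $ n = (fps_X * fps_const x) $ n" for n
        by (cases n; cases "n - 1") auto
    qed
    finally show "?g * (1 + fps_const x * fps_X) =
        fps_X * fps_deriv (1 + fps_const x * fps_X)" by simp
  qed simp
  with assms show ?thesis by simp
qed

lemma log_deriv_one_minus_X_power:
  assumes "k > 0" and "d > 0"
  shows "log_deriv (1 - fps_X ^ k) $ d = (if k dvd d then - of_nat k else 0)"
proof -
  let ?g = "Abs_fps (\<lambda>d. if d > 0 \<and> k dvd d then - of_nat k else (0 :: complex))"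
  have "log_deriv (1 - fps_X ^ k) = ?g"
  proof (rule log_deriv_unique)
    have "?g * (1 - fps_X ^ k) = ?g - fps_X ^ k * ?g" by (simp add: algebra_simps)
    also have "\<dots> = - fps_const (of_nat k) * fps_X ^ k"
    proof (rule fps_ext)
      fix n
      have "k dvd n - k \<longleftrightarrow> k dvd n" if "k \<le> n" using that by (simp add: dvd_minus_self)
      moreover have "n = 0 \<or> \<not> k dvd n" if "n < k" using that by (auto dest: dvd_imp_le)
      ultimately show "(?g - fps_X ^ k * ?g) $ n = (- fps_const (of_nat k) * fps_X ^ k) $ n"
        using assms(1) by (auto simp: fps_X_power_mult_nth fps_X_power_nth not_less)
    qed
    also have "\<dots> = fps_X * fps_deriv (1 - fps_X ^ k)"
      using assms(1) by (intro fps_ext) (auto simp: fps_X_power_nth)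
    finally show "?g * (1 - fps_X ^ k) = fps_X * fps_deriv (1 - fps_X ^ k)" .
  qed (use assms in simp)
  with assms show ?thesis by simp
qed

section \<open>The necklace functional\<close>

text \<open>
  The name comes from the value at \<open>1 - c X\<close>: it is \<open>(1/m) \<Sum>\<phi>(m/d) c\<^sup>d\<close> over the divisors \<open>d\<close> of \<open>m\<close>, which
  counts the necklaces of \<open>m\<close> beads in \<open>c\<close> colours.
\<close>

definition necklace :: "nat \<Rightarrow> complex fps \<Rightarrow> complex" where
  "necklace m f = - (\<Sum>d | d dvd m. of_nat (totient (m div d)) * log_deriv f $ d) / of_nat m"

lemma necklace_mult:
  assumes "f $ 0 \<noteq> 0" and "g $ 0 \<noteq> 0"
  shows "necklace m (f * g) = necklace m f + necklace m g"
  by (simp add: necklace_def log_deriv_mult assms sum.distrib algebra_simps add_divide_distrib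
      diff_divide_distrib)

lemma necklace_one [simp]: "necklace m 1 = 0"
  by (simp add: necklace_def log_deriv_def)

lemma necklace_power:
  assumes "f $ 0 = 1"
  shows "necklace m (f ^ e) = of_nat e * necklace m f"
  using assms by (induction e) (simp_all add: necklace_mult fps_nth_power_0 algebra_simps)

text \<open>
  If \<open>m = k l\<close>, then the multiples \<open>d\<close> of \<open>k\<close> that divide \<open>m\<close> correspond to the divisors \<open>e = m / d\<close> of
  \<open>l\<close>, so this is the formula \<open>\<Sum>\<phi>(e) = l\<close>.
\<close>

lemma sum_totient_multiples:
  assumes "k > 0" and "m > 0" and "k dvd m"
  shows "(\<Sum>d | d dvd m \<and> k dvd d. totient (m div d)) = m div k"
proof -
  obtain l where l: "m = k * l" using assms(3) by auto
  have "(\<Sum>d | d dvd m \<and> k dvd d. totient (m div d)) = (\<Sum>e | e dvd l. totient e)"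
  proof (rule sum.reindex_bij_witness[of _ "\<lambda>e. k * (l div e)" "\<lambda>d. m div d"])
    fix d assume "d \<in> {d. d dvd m \<and> k dvd d}"
    then obtain t s where ts: "d = k * t" "m = d * s" by (auto elim!: dvdE)
    with assms l have "l = t * s" "t > 0" by (auto simp: mult.assoc)
    with ts assms show "k * (l div (m div d)) = d" "m div d \<in> {e. e dvd l}" by auto
  next
    fix e assume "e \<in> {e. e dvd l}"
    then obtain t where t: "l = e * t" by (auto elim!: dvdE)
    with l have m: "m = e * (k * t)" by simp
    with assms have "e > 0" "t > 0" by auto
    with t m assms show "m div (k * (l div e)) = e" "k * (l div e) \<in> {d. d dvd m \<and> k dvd d}"
      by auto
  qed auto
  thus ?thesis using assms l by (simp add: totient_divisor_sum)
qed

lemma necklace_one_minus_X_power: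
  assumes "k > 0" and "m > 0"
  shows "necklace m (1 - fps_X ^ k) = (if k dvd m then 1 else 0)"
proof -
  have fin: "finite {d. d dvd m}" using assms(2) by simp
  have "(\<Sum>d | d dvd m. of_nat (totient (m div d)) * log_deriv (1 - fps_X ^ k) $ d)
      = (\<Sum>d | d dvd m. if k dvd d then - of_nat k * of_nat (totient (m div d)) else 0)"
    using assms by (intro sum.cong) (auto simp: log_deriv_one_minus_X_power dvd_pos_nat)
  also have "\<dots> = - of_nat k * of_nat (\<Sum>d | d dvd m \<and> k dvd d. totient (m div d))"
    using fin by (simp add: sum.If_cases Int_def sum_distrib_left sum_negf)
  finally have *: "necklace m (1 - fps_X ^ k) =
      of_nat k * of_nat (\<Sum>d | d dvd m \<and> k dvd d. totient (m div d)) / of_nat m"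
    by (simp add: necklace_def)
  show ?thesis
  proof (cases "k dvd m")
    case True
    with * assms show ?thesis
      by (simp add: sum_totient_multiples flip: of_nat_mult)
  next
    case False
    hence "{d. d dvd m \<and> k dvd d} = {}" by (auto dest: dvd_trans)
    with * False show ?thesis by simp
  qed
qed

text \<open>
  The factor \<open>1 + X\<^sup>k = (1 - X\<^sup>2\<^sup>k) / (1 - X\<^sup>k)\<close> has leading term \<open>X\<^sup>k\<close> with the opposite sign. It does the
  work of \<open>1 / (1 - X\<^sup>k)\<close> in the elimination of coefficients below, without negative exponents.
\<close>

lemma necklace_one_plus_X_power:
  assumes "k > 0" and "m > 0"
  shows "necklace m (1 + fps_X ^ k) \<in> \<int>"
proof -
  have "(1 - y) * (1 + y) = 1 - y * y" for y :: "complex fps" by (simp add: algebra_simps)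
  hence "(1 - fps_X ^ k) * (1 + fps_X ^ k) = (1 - fps_X ^ (2 * k) :: complex fps)"
    by (simp only: mult_2 power_add)
  with necklace_mult[of "1 - fps_X ^ k" "1 + fps_X ^ k" m] assms
  have "necklace m (1 + fps_X ^ k) =
      necklace m (1 - fps_X ^ (2 * k)) - necklace m (1 - fps_X ^ k)" by simp
  with assms show ?thesis by (simp add: necklace_one_minus_X_power)
qed

lemma necklace_eq_0:
  assumes "m > 0" and "f $ 0 = 1" and "\<And>i. 0 < i \<Longrightarrow> i \<le> m \<Longrightarrow> f $ i = 0"
  shows "necklace m f = 0"
proof -
  have "(fps_X * fps_deriv f) $ i = 0" if "i \<le> m" for i
    using assms(3)[of i] that by (cases i) auto
  hence "log_deriv f $ d = 0" if "d \<le> m" for d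
    using that unfolding log_deriv_def fps_mult_nth[of "fps_X * fps_deriv f"]
    by (intro sum.neutral) auto
  thus ?thesis using assms(1) by (simp add: necklace_def dvd_imp_le)
qed

section \<open>Integrality\<close>

definition complex_fps :: "int fps \<Rightarrow> complex fps" where
  "complex_fps f = Abs_fps (\<lambda>i. of_int (f $ i))"

lemma complex_fps_nth [simp]: "complex_fps f $ i = of_int (f $ i)"
  by (simp add: complex_fps_def)

lemma complex_fps_mult: "complex_fps (f * g) = complex_fps f * complex_fps g"
  by (rule fps_ext) (simp add: fps_mult_nth)

lemma complex_fps_power: "complex_fps (f ^ e) = complex_fps f ^ e"
proof (induction e)
  case 0
  show ?case by (rule fps_ext) simp
qed (simp add: complex_fps_mult)

lemma complex_fps_one_plus_minus:
  "complex_fps (1 - fps_X ^ k) = 1 - fps_X ^ k"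
  "complex_fps (1 + fps_X ^ k) = 1 + fps_X ^ k"
  by (rule fps_ext; simp add: fps_X_power_nth)+

text \<open>
  Series of the form \<open>1 + c X\<^sup>N + \<dots>\<close> multiply by adding their leading coefficients \<open>c\<close>.
\<close>

lemma leading_coeff_mult:
  fixes f g :: "int fps"
  assumes "f $ 0 = 1" and "g $ 0 = 1"
    and "\<And>i. 0 < i \<Longrightarrow> i < N \<Longrightarrow> f $ i = 0" and "\<And>i. 0 < i \<Longrightarrow> i < N \<Longrightarrow> g $ i = 0"
  shows "(f * g) $ 0 = 1" and "0 < i \<Longrightarrow> i < N \<Longrightarrow> (f * g) $ i = 0"
    and "N > 0 \<Longrightarrow> (f * g) $ N = f $ N + g $ N"
proof -
  have eq: "(f * g) $ n = f $ n + g $ n" if n: "0 < n" "n \<le> N" for n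
  proof -
    have "(f * g) $ n = (\<Sum>i=0..n. f $ i * g $ (n - i))" by (simp add: fps_mult_nth)
    also have "\<dots> = (\<Sum>i\<in>{0, n}. f $ i * g $ (n - i))"
      using n assms(3) by (intro sum.mono_neutral_right) auto
    finally show ?thesis using n assms by simp
  qed
  show "(f * g) $ 0 = 1" using assms by simp
  show "(f * g) $ i = 0" if "0 < i" "i < N" using eq[of i] that assms by simp
  show "(f * g) $ N = f $ N + g $ N" if "N > 0" using eq[of N] that by simp
qed

lemma leading_coeff_power:
  fixes f :: "int fps"
  assumes "f $ 0 = 1" and "\<And>i. 0 < i \<Longrightarrow> i < N \<Longrightarrow> f $ i = 0" and "N > 0"
  shows "(f ^ e) $ 0 = 1 \<and> (\<forall>i. 0 < i \<longrightarrow> i < N \<longrightarrow> (f ^ e) $ i = 0) \<and>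
    (f ^ e) $ N = int e * f $ N"
proof (induction e)
  case 0
  show ?case using assms by simp
next
  case (Suc e)
  show ?case using leading_coeff_mult[of f "f ^ e" N] Suc assms by (simp add: algebra_simps)
qed

text \<open>
  Downward induction on \<open>N\<close>. A series that agrees with 1 up to degree \<open>m\<close> has value 0. If it starts
  with \<open>1 + c X\<^sup>N\<close>, then multiplication by \<open>(1 - X\<^sup>N)\<^sup>c\<close>, or by \<open>(1 + X\<^sup>N)\<^sup>-\<^sup>c\<close> when \<open>c < 0\<close>, removes the
  term of degree \<open>N\<close> and changes the value by an integer.
\<close>

lemma necklace_Ints_aux:
  assumes "m > 0" and "f $ 0 = 1" and "N > 0" and "N \<le> Suc m"
    and "\<And>i. 0 < i \<Longrightarrow> i < N \<Longrightarrow> f $ i = 0"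
  shows "necklace m (complex_fps f) \<in> \<int>"
  using assms(4,2,3,5)
proof (induction N arbitrary: f rule: inc_induct)
  case base
  thus ?case using assms(1) by (subst necklace_eq_0) auto
next
  case (step N)
  define g :: "int fps" where "g = (if f $ N \<ge> 0 then 1 - fps_X ^ N else 1 + fps_X ^ N)"
  define e where "e = nat \<bar>f $ N\<bar>"
  have g: "g $ 0 = 1" "\<And>i. 0 < i \<Longrightarrow> i < N \<Longrightarrow> g $ i = 0" "int e * g $ N = - (f $ N)"
    using step.prems by (auto simp: g_def e_def fps_X_power_nth)
  have ge: "(g ^ e) $ 0 = 1" "\<And>i. 0 < i \<Longrightarrow> i < N \<Longrightarrow> (g ^ e) $ i = 0" "(g ^ e) $ N = - (f $ N)"
    using leading_coeff_power[of g N e] g step.prems by auto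
  have "necklace m (complex_fps (f * g ^ e)) \<in> \<int>"
  proof (rule step.IH)
    show "(f * g ^ e) $ i = 0" if "0 < i" "i < Suc N" for i
      using leading_coeff_mult(2,3)[of f "g ^ e" N] that step.prems ge
      by (cases "i = N") auto
  qed (use step.prems ge in auto)
  moreover have "necklace m (complex_fps (f * g ^ e)) =
      necklace m (complex_fps f) + of_nat e * necklace m (complex_fps g)"
    using step.prems ge g
    by (simp add: complex_fps_mult necklace_mult necklace_power complex_fps_power fps_nth_power_0)
  moreover have "necklace m (complex_fps g) \<in> \<int>"
    using step.prems assms(1)
    by (simp add: g_def complex_fps_one_plus_minus necklace_one_minus_X_power
        necklace_one_plus_X_power)
  ultimately show ?case
    by (metis Ints_diff Ints_mult Ints_of_nat add_diff_cancel_right')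
qed

lemma necklace_Ints:
  assumes "m > 0" and "f $ 0 = 1"
  shows "necklace m (complex_fps f) \<in> \<int>"
  by (rule necklace_Ints_aux[where N = 1]) (use assms in auto)

section \<open>Square roots and congruence modulo 4\<close>

text \<open>
  The equation \<open>b z + z\<^sup>2 = c\<close> with \<open>b\<close> starting with 1 and \<open>z\<close> starting with 0 determines each coefficient
  of \<open>z\<close> from the earlier ones: in degree \<open>n\<close>, the coefficient \<open>z\<^sub>n\<close> itself enters only through the product
  with the constant term of \<open>b\<close>. No division occurs, so \<open>z\<close> has integer coefficients.
\<close>

fun quadratic_root_coeff :: "int fps \<Rightarrow> int fps \<Rightarrow> nat \<Rightarrow> int" where
  "quadratic_root_coeff b c n = (if n = 0 then 0 else
     c $ n - (\<Sum>i<n. b $ (n - i) * quadratic_root_coeff b c i)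
       - (\<Sum>i\<in>{1..<n}. quadratic_root_coeff b c i * quadratic_root_coeff b c (n - i)))"

(* as a rewrite rule, the defining equation would unfold forever *)
declare quadratic_root_coeff.simps [simp del]

lemma quadratic_root_exists:
  fixes b c :: "int fps"
  assumes "b $ 0 = 1" and "c $ 0 = 0"
  shows "\<exists>z. z $ 0 = 0 \<and> b * z + z ^ 2 = c"
proof -
  define z where "z = Abs_fps (quadratic_root_coeff b c)"
  have z0: "z $ 0 = 0" by (simp add: z_def quadratic_root_coeff.simps)
  have "(b * z + z ^ 2) $ n = c $ n" for n
  proof (cases "n = 0")
    case False
    have "(z * b) $ n = z $ n + (\<Sum>i<n. b $ (n - i) * z $ i)"
      unfolding fps_mult_nth atLeast0AtMost lessThan_Suc_atMost[symmetric]
      using assms(1) by (simp add: mult.commute)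
    moreover have "(z ^ 2) $ n = (\<Sum>i\<in>{1..<n}. z $ i * z $ (n - i))"
      unfolding power2_eq_square fps_mult_nth
    proof (rule sum.mono_neutral_right)
      show "\<forall>i\<in>{0..n} - {1..<n}. z $ i * z $ (n - i) = 0"
      proof
        fix i assume "i \<in> {0..n} - {1..<n}"
        hence "i = 0 \<or> i = n" by auto
        thus "z $ i * z $ (n - i) = 0" using z0 by auto
      qed
    qed auto
    moreover have "z $ n = c $ n - (\<Sum>i<n. b $ (n - i) * z $ i)
        - (\<Sum>i\<in>{1..<n}. z $ i * z $ (n - i))"
      using False by (simp add: z_def quadratic_root_coeff.simps[of b c n])
    ultimately show ?thesis by (simp add: mult.commute)
  qed (use assms z0 in \<open>simp add: power2_eq_square\<close>)
  with z0 show ?thesis by (blast intro: fps_ext)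
qed

text \<open>
  With \<open>f = g + 4 h\<close>, the product is \<open>f g = g\<^sup>2 + 4 h g\<close>. Completing the square, \<open>g + 2 z\<close> is a root of it
  if and only if \<open>g z + z\<^sup>2 = h g\<close>. Taking \<open>f g\<close> instead of \<open>f / g\<close> avoids inverting \<open>g\<close>.
\<close>

lemma sqrt_of_mult_cong_4:
  fixes f g h :: "int fps"
  assumes "f $ 0 = 1" and "g $ 0 = 1" and "f = g + 4 * h"
  shows "\<exists>r. r $ 0 = 1 \<and> r ^ 2 = f * g"
proof -
  have "h $ 0 = 0" using assms by (simp add: fps_numeral_nth_0 numeral_fps_const)
  then obtain z where z: "z $ 0 = 0" "g * z + z ^ 2 = h * g"
    using quadratic_root_exists[of g "h * g"] assms(2) by auto
  have "(g + 2 * z) ^ 2 = g ^ 2 + 4 * (g * z + z ^ 2)"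
    by (simp add: power2_eq_square algebra_simps)
  also have "\<dots> = f * g" using z(2) assms(3) by (simp add: power2_eq_square algebra_simps)
  finally show ?thesis using z(1) assms(2) by (intro exI[of _ "g + 2 * z"]) simp
qed

lemma necklace_cong_4:
  fixes f g h :: "int fps"
  assumes "m > 0" and "f $ 0 = 1" and "g $ 0 = 1" and "f = g + 4 * h"
  shows "\<exists>u v :: int. necklace m (complex_fps f) = of_int u \<and>
    necklace m (complex_fps g) = of_int v \<and> [u = v] (mod 2)"
proof -
  obtain r where r: "r $ 0 = 1" "r ^ 2 = f * g"
    using sqrt_of_mult_cong_4[OF assms(2-4)] by auto
  obtain u v w where uvw: "necklace m (complex_fps f) = of_int u"
      "necklace m (complex_fps g) = of_int v" "necklace m (complex_fps r) = of_int w"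
    using necklace_Ints[OF assms(1)] assms(2,3) r(1) by (metis Ints_cases)
  have "necklace m (complex_fps (r ^ 2)) = necklace m (complex_fps (f * g))"
    by (simp add: r(2))
  hence "complex_of_int (2 * w) = of_int (u + v)"
    using assms r(1) uvw
    by (simp add: complex_fps_mult complex_fps_power necklace_mult necklace_power)
  hence "u + v = 2 * w" by (metis of_int_eq_iff)
  hence "[u = v] (mod 2)" by (simp add: cong_iff_dvd_diff)
  with uvw show ?thesis by blast
qed

section \<open>From the roots to the power series\<close>

definition esym_fps :: "nat \<Rightarrow> (nat \<Rightarrow> int) \<Rightarrow> int fps" where
  "esym_fps n a = Abs_fps (\<lambda>i. if i = 0 then 1 else if i \<le> n then a i else 0)"

lemma coeff_esym_poly:
  "coeff (esym_poly n a) k =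
    (if k = n then 1 else if k < n then (-1) ^ (n - k) * of_int (a (n - k)) else 0)"
proof -
  have "(\<Sum>i=1..n. if n - i = k then (-1) ^ i * complex_of_int (a i) else 0) =
      (\<Sum>i\<in>{1..n}. if i = n - k then (if k < n then (-1) ^ i * of_int (a i) else 0) else 0)"
    by (intro sum.cong) auto
  also have "\<dots> = (if k < n then (-1) ^ (n - k) * of_int (a (n - k)) else 0)"
    by (subst sum.delta) auto
  finally show ?thesis by (auto simp: esym_poly_def coeff_sum coeff_monom)
qed

lemma degree_esym_poly: "degree (esym_poly n a) = n"
  by (intro antisym degree_le le_degree) (auto simp: coeff_esym_poly)

text \<open>
  Reflecting \<open>\<Prod>(X - \<theta>)\<close> gives \<open>\<Prod>(1 - \<theta> X)\<close>. The sign \<open>(-1)\<^sup>i\<close> is the substitution of \<open>-X\<close> for \<open>X\<close>, and it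
  cancels the alternating signs in the coefficients of the polynomial.
\<close>

lemma prod_linear_factors_nth:
  fixes M :: "complex multiset"
  shows "(\<Prod>x\<in>#M. 1 + fps_const x * fps_X) $ i =
    (-1) ^ i * coeff (reflect_poly (\<Prod>x\<in>#M. [:- x, 1:])) i"
proof (induction M arbitrary: i)
  case empty
  show ?case by simp
next
  case (add x M)
  have "reflect_poly [:- x, 1:] = [:1, - x:]" by (simp add: reflect_poly_def)
  moreover define p where "p = (\<Prod>x\<in>#M. [:- x, 1:])"
  ultimately have "reflect_poly (\<Prod>x\<in>#add_mset x M. [:- x, 1:]) = [:1, - x:] * reflect_poly p"
    by (simp only: image_mset_add_mset prod_mset.add_mset reflect_poly_mult)
  moreover have "(\<Prod>x\<in>#add_mset x M. 1 + fps_const x * fps_X) =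
      (\<Prod>x\<in>#M. 1 + fps_const x * fps_X) +
      fps_X * (fps_const x * (\<Prod>x\<in>#M. 1 + fps_const x * fps_X))"
    by (simp add: algebra_simps)
  ultimately show ?case
    by (cases i) (simp_all add: add.IH right_diff_distrib mult.left_commute flip: p_def)
qed

lemma esym_fps_eq_prod:
  "complex_fps (esym_fps n a) = (\<Prod>x\<in>#proots (esym_poly n a). 1 + fps_const x * fps_X)"
proof (rule fps_ext)
  fix i
  have "(\<Prod>x\<in>#proots (esym_poly n a). [:- x, 1:]) = esym_poly n a"
    using complex_poly_decompose_multiset[of "esym_poly n a"]
    by (simp add: degree_esym_poly coeff_esym_poly)
  thus "complex_fps (esym_fps n a) $ i =
      (\<Prod>x\<in>#proots (esym_poly n a). 1 + fps_const x * fps_X) $ i"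
    by (auto simp: prod_linear_factors_nth esym_fps_def coeff_reflect_poly degree_esym_poly
        coeff_esym_poly simp flip: power_add mult.assoc power_mult_distrib)
qed

lemma complex_totient:
  "complex_of_nat (totient k) = of_nat k * (\<Prod>p\<in>prime_factors k. 1 - 1 / of_nat p)"
proof -
  have "complex_of_real (real (totient k)) =
      of_real (real k * (\<Prod>p\<in>prime_factors k. 1 - 1 / real p))"
    by (simp only: totient_formula2)
  thus ?thesis by simp
qed

lemma F_eq_necklace:
  assumes "m > 0"
  shows "F n m a = necklace m (complex_fps (esym_fps n a))"
proof -
  let ?R = "proots (esym_poly n a)"
  have "(-1) ^ d * ((\<Sum>\<theta>\<in>#?R. \<theta> ^ d) / of_nat d) *
        (\<Prod>p\<in>prime_factors (m div d). 1 - 1 / of_nat p) =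
      - (of_nat (totient (m div d)) * log_deriv (complex_fps (esym_fps n a)) $ d) / of_nat m"
    if "d dvd m" for d
  proof -
    have d: "d > 0" using that assms by (simp add: dvd_pos_nat)
    have "log_deriv (complex_fps (esym_fps n a)) $ d =
        (\<Sum>\<theta>\<in>#?R. log_deriv (1 + fps_const \<theta> * fps_X) $ d)"
      unfolding esym_fps_eq_prod by (rule log_deriv_prod_mset) simp
    also have "\<dots> = (\<Sum>\<theta>\<in>#?R. - ((-1) ^ d) * \<theta> ^ d)"
      using d by (intro arg_cong[where f = sum_mset] image_mset_cong)
        (subst log_deriv_linear_factor, simp, subst power_minus, simp)
    also have "\<dots> = - ((-1) ^ d) * (\<Sum>\<theta>\<in>#?R. \<theta> ^ d)"
      by (rule sum_mset_distrib_left[symmetric])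
    finally have L: "log_deriv (complex_fps (esym_fps n a)) $ d =
        - ((-1) ^ d) * (\<Sum>\<theta>\<in>#?R. \<theta> ^ d)" .
    obtain e where e: "m = d * e" using \<open>d dvd m\<close> by (elim dvdE)
    with assms have "e > 0" by auto
    with d e show ?thesis by (simp add: L complex_totient field_simps)
  qed
  thus ?thesis unfolding F_def necklace_def
    by (simp add: sum_divide_distrib sum_negf)
qed

theorem theorem2p3:
  fixes n m j :: nat and a a' :: "nat \<Rightarrow> int"
  assumes "n \<ge> 1" and "m \<ge> 1" and "1 \<le> j" and "j \<le> n"
    and "\<And>i. i \<in> {1..n} \<Longrightarrow> i \<noteq> j \<Longrightarrow> a' i = a i"
    and "a' j = a j + 4"
  shows "\<exists>u v :: int. F n m a = of_int u \<and> F n m a' = of_int v \<and> [u = v] (mod 2)"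
proof -
  have "esym_fps n a = esym_fps n a' + 4 * (- (fps_X ^ j))"
  proof (rule fps_ext)
    show "esym_fps n a $ i = (esym_fps n a' + 4 * (- (fps_X ^ j))) $ i" for i
      using assms(3-6)
      by (cases "i = j") (auto simp: esym_fps_def numeral_fps_const fps_X_power_nth)
  qed
  hence "\<exists>u v :: int. necklace m (complex_fps (esym_fps n a)) = of_int u \<and>
      necklace m (complex_fps (esym_fps n a')) = of_int v \<and> [u = v] (mod 2)"
    using assms(2,3) by (intro necklace_cong_4[where h = "- (fps_X ^ j)"]) (auto simp: esym_fps_def)
  thus ?thesis using assms(2) by (simp add: F_eq_necklace)
qed

end
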